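(* Every Jordan curve $\gamma:S^1\to\mathbb{R}^2$ inscribes uncountably many rhombi; that is, the set of inscribed rhombi of $\gamma$ is uncountable.
   Context: A Jordan curve is a continuous injective map $\gamma:S^1\to\mathbb{R}^2$; no regularity is assumed. Its image is denoted $\operatorname{im}(\gamma)$. An inscribed rhombus of $\gamma$ is a set of 4 distinct points in $\operatorname{im}(\gamma)$ which are the vertices of a rhombus in $\mathbb{R}^2$. *)

theory Defs
  imports "HOL-Analysis.Analysis"
begin

text \<open>
  \<open>S\<^sup>1\<close> is the unit circle in the complex plane. The values of \<open>\<gamma>\<close> off the circle play no role.
\<close>

definition jordan_curve :: "(complex \<Rightarrow> real^2) \<Rightarrow> bool" where
  "jordan_curve \<gamma> \<longleftrightarrow> continuous_on (sphere 0 1) \<gamma> \<and> inj_on \<gamma> (sphere 0 1)"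

text \<open>
  A rhombus is a quadrilateral with four equal sides, and \<open>a\<close>, \<open>b\<close>, \<open>c\<close>, \<open>d\<close> are its vertices in
  cyclic order. In the plane, distinctness of the four vertices already excludes degenerate
  (collinear) configurations: \<open>b\<close> and \<open>d\<close> lie on the perpendicular bisector of \<open>a\<close> and \<open>c\<close>, at the
  same nonzero distance from the midpoint and on opposite sides of it.
\<close>

definition rhombus :: "real^2 \<Rightarrow> real^2 \<Rightarrow> real^2 \<Rightarrow> real^2 \<Rightarrow> bool" where
  "rhombus a b c d \<longleftrightarrow>
     distinct [a, b, c, d] \<and> dist a b = dist b c \<and> dist b c = dist c d \<and> dist c d = dist d a"

definition inscribed_rhombus :: "(complex \<Rightarrow> real^2) \<Rightarrow> (real^2) set \<Rightarrow> bool" where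
  "inscribed_rhombus \<gamma> R \<longleftrightarrow>
     R \<subseteq> \<gamma> ` sphere 0 1 \<and> (\<exists>a b c d. R = {a, b, c, d} \<and> rhombus a b c d)"

end

theory Submission
  imports Defs
begin

text \<open>
  For every slope \<open>k\<close> the curve inscribes a rhombus with two sides of slope \<open>k\<close>. A rhombus has only
  finitely many pairs of vertices and so only finitely many slopes, whereas there are uncountably
  many \<open>k\<close>; hence there are uncountably many rhombi.

  To find the rhombus, regard lines of slope \<open>k\<close> as horizontal and cut the curve at a highest point
  and a lowest point into two arcs \<open>L\<close> and \<open>R\<close>, both running downwards from one to the other. By the
  mountain climbing theorem two points can travel simultaneously down \<open>L\<close> and \<open>R\<close> while staying at
  nearly the same height. Let \<open>F\<close> be the length of the chord joining them. It vanishes at both ends of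
  the journey and is bounded below by some \<open>c > 0\<close> outside neighbourhoods of the two ends, so there
  is a middle part of the journey on which \<open>F \<ge> c\<close>, with \<open>F = c\<close> at its two ends. Now send one chord
  forwards and another one backwards from these ends to a place where \<open>F\<close> is maximal,
  keeping their lengths equal (mountain climbing again, for \<open>F\<close> itself). At the start the left
  endpoints of the two chords are further apart than the length \<open>c\<close> of the chords; at the end the
  chords coincide. In between the left endpoints are exactly one chord length apart
  (\<open>equal_values_at_prescribed_distance\<close>).

  This gives an almost horizontal pair of chords, and since \<open>c\<close> depends only on the curve, letting
  the height error tend to zero leaves two nondegenerate horizontal chords that are opposite
  sides of a rhombus (\<open>parallel_chords\<close>). Its vertices could still collide if both chords lie on one
  line and share an endpoint. Such an endpoint belongs to both \<open>L\<close> and \<open>R\<close>, so it is the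
  chosen highest or lowest point, and it is the midpoint of the two other endpoints. This is excluded
  by choosing the highest point leftmost and the lowest point rightmost at their heights.
\<close>

section \<open>Mountain climbing\<close>

lemma connected_real_zero:
  fixes h :: "'a::topological_space \<Rightarrow> real"
  assumes "connected S" "continuous_on S h" "a \<in> S" "b \<in> S" "h a \<le> 0" "0 \<le> h b"
  obtains z where "z \<in> S" "h z = 0"
proof -
  have "connected (h ` S)"
    using assms connected_continuous_image by blast
  then have "0 \<in> h ` S"
    using connectedD_interval[of "h ` S" "h a" "h b" 0] assms by blast
  then show thesis using that by force
qed

definition clamp01 :: "real \<Rightarrow> real" where
  "clamp01 x = max 0 (min 1 x)"

lemma clamp01_simps [simp]:
  "0 \<le> clamp01 x" "clamp01 x \<le> 1" "x \<le> 0 \<Longrightarrow> clamp01 x = 0" "1 \<le> x \<Longrightarrow> clamp01 x = 1"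
  "0 \<le> x \<Longrightarrow> x \<le> 1 \<Longrightarrow> clamp01 x = x"
  by (auto simp: clamp01_def)

lemma continuous_on_clamp01 [continuous_intros]:
  "continuous_on S f \<Longrightarrow> continuous_on S (\<lambda>x. clamp01 (f x))"
  unfolding clamp01_def by (intro continuous_intros)

lemma continuous_on_compose_clamp01:
  assumes "continuous_on {0..1} f" "continuous_on S g"
  shows "continuous_on S (\<lambda>x. f (clamp01 (g x)))"
  by (rule continuous_on_compose2[OF assms(1)]) (auto intro!: continuous_intros assms)

text \<open>
  Extend \<open>f\<close> and \<open>g\<close> by lines of slope \<open>1\<close> to all of \<open>\<real>\<close>. Then the set \<open>E\<close> where \<open>F s = G t\<close> is the wanted
  set inside the unit square together with two diagonal rays leaving it at the corners \<open>(0,0)\<close> and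
  \<open>(1,1)\<close>. It separates a point below the diagonal from one above it, so a single component of it
  does. That component must meet each of the two paths around the square, which cross
  \<open>E\<close> only on the rays; hence it contains points of both rays, and clamping the
  coordinates pulls it back into the square.
\<close>
lemma mountain_climbing_connected:
  fixes f g :: "real \<Rightarrow> real"
  assumes contf: "continuous_on {0..1} f" and contg: "continuous_on {0..1} g"
    and ends: "f 0 = lo" "g 0 = lo" "f 1 = hi" "g 1 = hi"
    and rf: "\<And>x. x \<in> {0..1} \<Longrightarrow> f x \<in> {lo..hi}"
    and rg: "\<And>x. x \<in> {0..1} \<Longrightarrow> g x \<in> {lo..hi}"
  obtains K where "connected K" "K \<subseteq> {0..1} \<times> {0..1}" "(0,0) \<in> K" "(1,1) \<in> K"
    "\<And>s t. (s,t) \<in> K \<Longrightarrow> f s = g t"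
proof -
  define F where "F x = f (clamp01 x) + (x - clamp01 x)" for x
  define G where "G x = g (clamp01 x) + (x - clamp01 x)" for x
  define h where "h z = F (fst z) - G (snd z)" for z :: "real \<times> real"
  have conth: "continuous_on S h" for S
    unfolding h_def F_def G_def
    by (intro continuous_intros continuous_on_compose_clamp01[OF contf]
        continuous_on_compose_clamp01[OF contg])
  have Fc: "x < 0 \<and> F x = lo + x \<or> x \<in> {0..1} \<and> F x = f x \<and> F x \<in> {lo..hi} \<or> x > 1 \<and> F x = hi + (x - 1)" for x
    using rf[of x] ends by (cases "x < 0"; cases "x > 1") (auto simp: F_def)
  have Gc: "x < 0 \<and> G x = lo + x \<or> x \<in> {0..1} \<and> G x = g x \<and> G x \<in> {lo..hi} \<or> x > 1 \<and> G x = hi + (x - 1)" for x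
    using rg[of x] ends by (cases "x < 0"; cases "x > 1") (auto simp: G_def)
  have lohi: "lo \<le> hi" using rf[of 0] by auto
  define E where "E = h -` {0}"
  have clE: "closed E"
    unfolding E_def using conth[of UNIV] by (intro closed_vimage) auto
  have E_iff: "(s,t) \<in> E \<longleftrightarrow> F s = G t" for s t
    by (auto simp: E_def h_def)
  define P Q where "P = (2::real, -1::real)" and "Q = (-1::real, 2::real)"
  have hP: "h P > 0" and hQ: "h Q < 0"
    using Fc[of 2] Gc[of "-1"] Fc[of "-1"] Gc[of 2] lohi by (auto simp: h_def P_def Q_def)
  have "\<not> connected_component (- E) P Q"
  proof
    assume "connected_component (- E) P Q"
    then obtain T where T: "connected T" "T \<subseteq> - E" "P \<in> T" "Q \<in> T"
      by (auto simp: connected_component_def)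
    obtain z where "z \<in> T" "h z = 0"
      using connected_real_zero[OF T(1) conth T(4,3)] hP hQ by auto
    then show False using T(2) by (auto simp: E_def)
  qed
  then obtain C where C: "C \<in> components E" and sep: "\<not> connected_component (- C) P Q"
    using separation_by_component_closed_pointwise[OF clE] by blast
  have CE: "C \<subseteq> E" and conC: "connected C"
    using C in_components_subset in_components_connected by auto
  have corner: "(a,a) \<in> C" if a: "a = -1 \<or> a = 2" for a :: real
  proof (rule ccontr)
    assume n: "(a,a) \<notin> C"
    define A where "A = {-1..2::real} \<times> {a} \<union> {a} \<times> {-1..2::real}"
    have "connected A"
      unfolding A_def
    proof (intro connected_Un connected_Times)
      have "(a,a) \<in> {-1..2} \<times> {a} \<inter> {a} \<times> {-1..2}" using a by auto
      then show "{-1..2} \<times> {a} \<inter> {a} \<times> {-1..2} \<noteq> {}" by blast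
    qed auto
    moreover have "A \<subseteq> - C"
    proof
      fix z assume z: "z \<in> A"
      show "z \<in> - C"
      proof
        assume "z \<in> C"
        then obtain s t where st: "z = (s,t)" "F s = G t" using CE E_iff by (cases z) auto
        then have "s = a \<and> t = a"
          using Fc[of s] Gc[of t] lohi a z by (auto simp: A_def)
        then show False using st n \<open>z \<in> C\<close> by auto
      qed
    qed
    moreover have "P \<in> A" "Q \<in> A" using a by (auto simp: A_def P_def Q_def)
    ultimately show False using sep by (auto simp: connected_component_def)
  qed
  define r where "r z = (clamp01 (fst z), clamp01 (snd z))" for z
  show thesis
  proof (rule that[of "r ` C"])
    show "connected (r ` C)"
      unfolding r_def by (intro connected_continuous_image conC continuous_intros)
    show "r ` C \<subseteq> {0..1} \<times> {0..1}" by (auto simp: r_def)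
    show "(0,0) \<in> r ` C" using corner[of "-1"] by (force simp: r_def image_iff)
    show "(1,1) \<in> r ` C" using corner[of 2] by (force simp: r_def image_iff)
    fix s t assume "(s,t) \<in> r ` C"
    then obtain x y where xy: "(x,y) \<in> C" "s = clamp01 x" "t = clamp01 y"
      by (auto simp: r_def)
    have "F x = G y" using xy(1) CE E_iff by blast
    then show "f s = g t"
      using Fc[of x] Gc[of y] lohi ends by (auto simp: xy)
  qed
qed

text \<open>
  The connected set just found need not be path connected, but its open neighbourhood
  \<open>\<bar>f s - g t\<bar> < \<epsilon>\<close> has path connected components.
\<close>
lemma mountain_climbing_path:
  fixes f g :: "real \<Rightarrow> real"
  assumes contf: "continuous_on {0..1} f" and contg: "continuous_on {0..1} g"
    and ends: "f 0 = lo" "g 0 = lo" "f 1 = hi" "g 1 = hi"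
    and rf: "\<And>x. x \<in> {0..1} \<Longrightarrow> f x \<in> {lo..hi}"
    and rg: "\<And>x. x \<in> {0..1} \<Longrightarrow> g x \<in> {lo..hi}"
    and "\<epsilon> > 0"
  obtains \<sigma> \<tau> where "continuous_on {0..1} \<sigma>" "continuous_on {0..1} \<tau>"
    "\<sigma> ` {0..1} \<subseteq> {0..1}" "\<tau> ` {0..1} \<subseteq> {0..1}"
    "\<sigma> 0 = 0" "\<tau> 0 = 0" "\<sigma> 1 = 1" "\<tau> 1 = (1::real)"
    "\<And>u. u \<in> {0..1::real} \<Longrightarrow> \<bar>f (\<sigma> u) - g (\<tau> u)\<bar> < \<epsilon>"
proof -
  obtain K where K: "connected K" "K \<subseteq> {0..1} \<times> {0..1}" "(0,0) \<in> K" "(1,1) \<in> K"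
    "\<And>s t. (s,t) \<in> K \<Longrightarrow> f s = g t"
    using mountain_climbing_connected[OF contf contg ends rf rg] by blast
  define h where "h z = \<bar>f (clamp01 (fst z)) - g (clamp01 (snd z))\<bar>" for z
  define U where "U = h -` {..<\<epsilon>}"
  have "continuous_on UNIV h"
    unfolding h_def
    by (intro continuous_intros continuous_on_compose_clamp01[OF contf]
        continuous_on_compose_clamp01[OF contg])
  then have "open U" unfolding U_def by (intro open_vimage) auto
  have "K \<subseteq> U" using K(2,5) \<open>\<epsilon> > 0\<close> by (fastforce simp: U_def h_def)
  then have "connected_component U (0,0) (1,1)"
    using K by (auto simp: connected_component_def)
  then have "path_component U (0,0) (1,1)"
    using open_path_connected_component[OF \<open>open U\<close>] by metis
  then obtain p where p: "path p" "path_image p \<subseteq> U" "pathstart p = (0,0)" "pathfinish p = (1,1)"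
    by (auto simp: path_component_def)
  have "\<bar>f (clamp01 (fst (p u))) - g (clamp01 (snd (p u)))\<bar> < \<epsilon>" if "u \<in> {0..1}" for u
  proof -
    have "p u \<in> U" using p(2) that by (auto simp: path_image_def)
    then show ?thesis by (simp add: U_def h_def)
  qed
  then show thesis
    using p by (intro that[of "\<lambda>u. clamp01 (fst (p u))" "\<lambda>u. clamp01 (snd (p u))"])
      (auto simp: path_def pathstart_def pathfinish_def intro!: continuous_intros)
qed

section \<open>Two chords whose distance is their common length\<close>

text \<open>
  In the application \<open>p\<close> is the left endpoint of a moving chord and \<open>F\<close> its length. The hypothesis
  \<open>near\<close> says that short chords occur only near the two ends of the journey, so \<open>[\<alpha>, \<beta>]\<close> below is a
  passage from one end to the other with \<open>F \<ge> c\<close> throughout. Keeping \<open>F\<close> bounded away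
  from \<open>0\<close> here prevents the rhombus from collapsing to a point in the later limit.
\<close>
lemma equal_values_at_prescribed_distance:
  fixes p :: "real \<Rightarrow> 'a::metric_space" and F :: "real \<Rightarrow> real"
  assumes contp: "continuous_on {0..1} p" and contF: "continuous_on {0..1} F"
    and ends: "p 0 = a" "p 1 = b" "F 0 \<le> c" "F 1 \<le> c"
    and c: "0 < c" and cr: "c + 2 * r < dist a b" and r: "0 \<le> r"
    and near: "\<And>u. u \<in> {0..1} \<Longrightarrow> F u \<le> c \<Longrightarrow> dist (p u) a \<le> r \<or> dist (p u) b \<le> r"
  obtains u v where "0 \<le> u" "u \<le> v" "v \<le> 1" "F u = F v" "dist (p u) (p v) = F u"
    "\<And>w. w \<in> {u..v} \<Longrightarrow> c \<le> F w"
proof -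
  have clA: "compact {u \<in> {x..1}. F u \<le> c \<and> dist (p u) z \<le> r}" if "0 \<le> x" for x z
  proof -
    have sub: "{x..1} \<subseteq> {0..1}" using that by auto
    have "closed {u \<in> {x..1}. max (F u - c) (dist (p u) z - r) \<le> 0}"
      using sub by (intro continuous_on_closed_Collect_le continuous_intros
          continuous_on_subset[OF contp] continuous_on_subset[OF contF]) auto
    moreover have "{u \<in> {x..1}. max (F u - c) (dist (p u) z - r) \<le> 0}
        = {u \<in> {x..1}. F u \<le> c \<and> dist (p u) z \<le> r}" by auto
    moreover have "bounded {u \<in> {x..1}. F u \<le> c \<and> dist (p u) z \<le> r}"
      by (rule bounded_subset[of "{x..1}"]) auto
    ultimately show ?thesis by (simp add: compact_eq_bounded_closed)
  qed
  obtain \<alpha> where \<alpha>: "\<alpha> \<in> {0..1}" "F \<alpha> \<le> c" "dist (p \<alpha>) a \<le> r"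
    and \<alpha>max: "\<And>u. u \<in> {0..1} \<Longrightarrow> F u \<le> c \<Longrightarrow> dist (p u) a \<le> r \<Longrightarrow> u \<le> \<alpha>"
    using compact_attains_sup[OF clA[of 0 a]] ends r by force
  obtain \<beta> where \<beta>: "\<beta> \<in> {\<alpha>..1}" "F \<beta> \<le> c" "dist (p \<beta>) b \<le> r"
    and \<beta>min: "\<And>u. u \<in> {\<alpha>..1} \<Longrightarrow> F u \<le> c \<Longrightarrow> dist (p u) b \<le> r \<Longrightarrow> \<beta> \<le> u"
    using compact_attains_inf[OF clA[of \<alpha> b]] \<alpha> ends r by force
  have sep: "c < dist (p \<alpha>) (p \<beta>)"
    using \<alpha>(3) \<beta>(3) cr dist_triangle[of a b "p \<alpha>"] dist_triangle[of "p \<alpha>" b "p \<beta>"]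
    by (simp add: dist_commute)
  then have "\<alpha> < \<beta>" using \<beta>(1) c by (cases "\<alpha> = \<beta>") auto
  have sub: "{\<alpha>..\<beta>} \<subseteq> {0..1}" using \<alpha>(1) \<beta>(1) by auto
  have inner: "c \<le> F w" if "w \<in> {\<alpha><..<\<beta>}" for w
    using near[of w] \<alpha>max[of w] \<beta>min[of w] that \<alpha> \<beta> by force
  have Fge: "c \<le> F w" if "w \<in> {\<alpha>..\<beta>}" for w
  proof -
    have "closed {w \<in> {\<alpha>..\<beta>}. c \<le> F w}"
      using sub by (intro continuous_on_closed_Collect_le continuous_intros
          continuous_on_subset[OF contF]) auto
    then have "closure {\<alpha><..<\<beta>} \<subseteq> {w \<in> {\<alpha>..\<beta>}. c \<le> F w}"
      using inner by (intro closure_minimal) auto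
    then show ?thesis using that \<open>\<alpha> < \<beta>\<close> by auto
  qed
  have F\<alpha>\<beta>: "F \<alpha> = c" "F \<beta> = c"
    using Fge[of \<alpha>] Fge[of \<beta>] \<alpha> \<beta> \<open>\<alpha> < \<beta>\<close> by auto
  obtain m where m: "m \<in> {\<alpha>..\<beta>}" and mmax: "\<And>w. w \<in> {\<alpha>..\<beta>} \<Longrightarrow> F w \<le> F m"
    using continuous_attains_sup[of "{\<alpha>..\<beta>}" F] continuous_on_subset[OF contF sub] \<open>\<alpha> < \<beta>\<close> by auto
  define l where "l x = \<alpha> + x * (m - \<alpha>)" for x
  define k where "k x = \<beta> - x * (\<beta> - m)" for x
  have lr: "l x \<in> {\<alpha>..m}" and kr: "k x \<in> {m..\<beta>}" if "x \<in> {0..1}" for x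
    using that m mult_left_le_one_le[of "m - \<alpha>" x] mult_left_le_one_le[of "\<beta> - m" x]
    by (auto simp: l_def k_def)
  have lr': "l x \<in> {\<alpha>..\<beta>}" and kr': "k x \<in> {\<alpha>..\<beta>}" if "x \<in> {0..1}" for x
    using lr[OF that] kr[OF that] m by auto
  have cont_l: "continuous_on S l" and cont_k: "continuous_on S k" for S
    unfolding l_def k_def by (intro continuous_intros)+
  have lsub: "l ` {0..1} \<subseteq> {0..1}" and ksub: "k ` {0..1} \<subseteq> {0..1}"
    using lr' kr' sub by blast+
  \<comment> \<open>One chord climbs from \<open>\<alpha>\<close> up to the maximum at \<open>m\<close>, the other one from \<open>\<beta>\<close> back to \<open>m\<close>.\<close>
  obtain K where K: "connected K" "K \<subseteq> {0..1} \<times> {0..1}" "(0,0) \<in> K" "(1,1) \<in> K"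
    "\<And>s t. (s,t) \<in> K \<Longrightarrow> F (l s) = F (k t)"
  proof (rule mountain_climbing_connected[of "\<lambda>x. F (l x)" "\<lambda>x. F (k x)" c "F m"])
    show "continuous_on {0..1} (\<lambda>x. F (l x))" "continuous_on {0..1} (\<lambda>x. F (k x))"
      using continuous_on_compose2[OF contF cont_l lsub]
        continuous_on_compose2[OF contF cont_k ksub] by auto
    show "F (l 0) = c" "F (k 0) = c" "F (l 1) = F m" "F (k 1) = F m"
      using F\<alpha>\<beta> by (auto simp: l_def k_def)
  qed (use Fge mmax lr' kr' in auto)
  define h where "h z = F (l (fst z)) - dist (p (l (fst z))) (p (k (snd z)))" for z
  have K01: "fst z \<in> {0..1} \<and> snd z \<in> {0..1}" if "z \<in> K" for z
    using K(2) that by (auto simp: mem_Times_iff)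
  have fstK: "(l \<circ> fst) ` K \<subseteq> {0..1}" and sndK: "(k \<circ> snd) ` K \<subseteq> {0..1}"
    using K01 lsub ksub unfolding image_subset_iff comp_def by blast+
  have contlf: "continuous_on K (l \<circ> fst)" and contks: "continuous_on K (k \<circ> snd)"
    by (intro continuous_on_compose cont_l cont_k continuous_intros)+
  have "continuous_on K h"
    unfolding h_def
    using continuous_on_compose2[OF contF contlf fstK] continuous_on_compose2[OF contp contlf fstK]
      continuous_on_compose2[OF contp contks sndK]
    by (auto intro!: continuous_intros)
  moreover have "h (0,0) \<le> 0" using sep F\<alpha>\<beta> by (simp add: h_def l_def k_def)
  moreover have "0 \<le> h (1,1)" using Fge[OF m] c by (simp add: h_def l_def k_def)
  ultimately obtain s t where st: "(s,t) \<in> K" "h (s,t) = 0"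
    using connected_real_zero[OF K(1) _ K(3,4)] by (metis surj_pair)
  then have "s \<in> {0..1}" "t \<in> {0..1}" using K(2) by auto
  note b = lr[OF this(1)] kr[OF this(2)]
  show thesis
    by (rule that[of "l s" "k t"]) (use b sub K(5)[OF st(1)] st(2) Fge m \<open>\<alpha> < \<beta>\<close> in \<open>auto simp: h_def\<close>)
qed

section \<open>Parallel chords of a given slope\<close>

lemma norm_vertical:
  fixes W :: "real^2"
  assumes "W $ 1 = 0"
  shows "norm W = \<bar>W $ 2\<bar>"
  using assms by (simp add: norm_vec_def L2_set_def sum_2)

text \<open>
  The height relative to lines of slope \<open>k\<close>: two points have equal tilt iff their difference is a
  multiple of \<open>(1, k)\<close>. Together with the first coordinate it determines a point, which makes a
  rotation of the plane unnecessary.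
\<close>
definition tilt :: "real \<Rightarrow> real^2 \<Rightarrow> real" where
  "tilt k z = z $ 2 - k * z $ 1"

lemma tilt_diff: "tilt k (x - y) = tilt k x - tilt k y"
  and tilt_add: "tilt k (x + y) = tilt k x + tilt k y"
  by (simp_all add: tilt_def algebra_simps)

lemma continuous_on_tilt [continuous_intros]:
  "continuous_on S f \<Longrightarrow> continuous_on S (\<lambda>x. tilt k (f x))"
  unfolding tilt_def by (intro continuous_intros)

text \<open>
  The bound \<open>c\<close> is chosen before \<open>\<epsilon>\<close>; this uniformity is what makes the passage to the limit below
  nondegenerate. Lengths do not see the direction of a chord, so the last conjunct records that both
  chords point the same way: along the journey from one chord to the other
  the horizontal component cannot vanish, since then the chord would be vertical and so shorter than \<open>c\<close>.
\<close>
lemma approximate_parallel_chords: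
  fixes L R :: "real \<Rightarrow> real^2"
  assumes contL: "continuous_on {0..1} L" and contR: "continuous_on {0..1} R"
    and ends: "L 0 = R 0" "L 1 = R 1"
    and meet: "\<And>s t. s \<in> {0..1} \<Longrightarrow> t \<in> {0..1} \<Longrightarrow> L s = R t \<Longrightarrow> s = 0 \<and> t = 0 \<or> s = 1 \<and> t = 1"
    and rL: "\<And>s. s \<in> {0..1} \<Longrightarrow> tilt k (L s) \<in> {tilt k (L 1)..tilt k (L 0)}"
    and rR: "\<And>s. s \<in> {0..1} \<Longrightarrow> tilt k (R s) \<in> {tilt k (L 1)..tilt k (L 0)}"
  obtains c where "c > 0"
    "\<And>\<epsilon>. \<epsilon> > 0 \<Longrightarrow> \<exists>s\<in>{0..1}. \<exists>t\<in>{0..1}. \<exists>s'\<in>{0..1}. \<exists>t'\<in>{0..1}.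
       \<bar>tilt k (R t - L s)\<bar> < \<epsilon> \<and> \<bar>tilt k (R t' - L s')\<bar> < \<epsilon> \<and>
       c \<le> dist (L s) (R t) \<and> dist (L s') (R t') = dist (L s) (R t) \<and>
       dist (L s) (L s') = dist (L s) (R t) \<and> 0 \<le> (R t - L s) $ 1 * (R t' - L s') $ 1"
proof -
  define a b r where "a = L 0" and "b = L 1" and "r = dist a b / 4"
  have "a \<noteq> b" using meet[of 0 1] ends by (auto simp: a_def b_def)
  then have r0: "r > 0" by (simp add: r_def)
  define S :: "(real \<times> real) set" where "S = {z \<in> {0..1} \<times> {0..1}. r \<le> min (dist (L (fst z)) a) (dist (L (fst z)) b)}"
  have fst01: "fst ` ({0..1} \<times> {0..1}) \<subseteq> {0..1::real}" and snd01: "snd ` ({0..1} \<times> {0..1}) \<subseteq> {0..1::real}"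
    by auto
  have cL: "continuous_on ({0..1} \<times> {0..1}) (\<lambda>z::real\<times>real. L (fst z))"
   and cR: "continuous_on ({0..1} \<times> {0..1}) (\<lambda>z::real\<times>real. R (snd z))"
    by (rule continuous_on_compose2[OF contL _ fst01] continuous_on_compose2[OF contR _ snd01];
        intro continuous_intros)+
  have "closed S"
    unfolding S_def
    by (intro continuous_on_closed_Collect_le continuous_intros cL closed_Times)
  moreover have "bounded S"
    by (rule bounded_subset[of "{0..1} \<times> {0..1}"]) (auto simp: S_def intro: bounded_Times)
  ultimately have compS: "compact S" by (simp add: compact_eq_bounded_closed)
  have pos: "0 < dist (L s) (R t)" if "(s,t) \<in> S" for s t
    using that meet[of s t] r0 by (auto simp: S_def a_def b_def)
  obtain c1 where c1: "c1 > 0" "\<And>s t. (s,t) \<in> S \<Longrightarrow> c1 \<le> dist (L s) (R t)"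
  proof (cases "S = {}")
    case True
    then show thesis using that[of 1] by auto
  next
    case False
    have "continuous_on S (\<lambda>z. dist (L (fst z)) (R (snd z)))"
      by (intro continuous_intros continuous_on_subset[OF cL] continuous_on_subset[OF cR])
        (auto simp: S_def)
    from continuous_attains_inf[OF compS False this] obtain s t where
      st: "(s,t) \<in> S" "\<And>z. z \<in> S \<Longrightarrow> dist (L s) (R t) \<le> dist (L (fst z)) (R (snd z))"
      by force
    show thesis using that[OF pos[OF st(1)]] st(2) by force
  qed
  define c where "c = min (c1 / 2) r"
  have c: "0 < c" "c < c1" "c \<le> r" using c1 r0 by (auto simp: c_def)
  show thesis
  proof (rule that[OF c(1)])
    fix \<epsilon> :: real assume "\<epsilon> > 0"
    have "min \<epsilon> c > 0" using \<open>\<epsilon> > 0\<close> c by simp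
    obtain \<sigma> \<tau> where cont: "continuous_on {0..1} \<sigma>" "continuous_on {0..1} \<tau>"
      and sub: "\<sigma> ` {0..1} \<subseteq> {0..1}" "\<tau> ` {0..1} \<subseteq> {0..1}"
      and e01: "\<sigma> 0 = 0" "\<tau> 0 = 0" "\<sigma> 1 = 1" "\<tau> 1 = (1::real)"
      and close: "\<And>u. u \<in> {0..1::real} \<Longrightarrow> \<bar>- tilt k (L (\<sigma> u)) - - tilt k (R (\<tau> u))\<bar> < min \<epsilon> c"
      by (rule mountain_climbing_path[of "\<lambda>x. - tilt k (L x)" "\<lambda>x. - tilt k (R x)"
            "- tilt k (L 0)" "- tilt k (L 1)" "min \<epsilon> c"])
        (use contL contR ends rL rR \<open>min \<epsilon> c > 0\<close> in \<open>auto intro!: continuous_intros\<close>)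
    have contL\<sigma>: "continuous_on {0..1} (\<lambda>u. L (\<sigma> u))"
      and contR\<tau>: "continuous_on {0..1} (\<lambda>u. R (\<tau> u))"
      using continuous_on_compose2[OF contL cont(1) sub(1)]
        continuous_on_compose2[OF contR cont(2) sub(2)] by auto
    obtain u v where uv: "0 \<le> u" "u \<le> v" "v \<le> 1"
      "dist (L (\<sigma> u)) (R (\<tau> u)) = dist (L (\<sigma> v)) (R (\<tau> v))"
      "dist (L (\<sigma> u)) (L (\<sigma> v)) = dist (L (\<sigma> u)) (R (\<tau> u))"
      "\<And>w. w \<in> {u..v} \<Longrightarrow> c \<le> dist (L (\<sigma> w)) (R (\<tau> w))"
    proof (rule equal_values_at_prescribed_distance[of "\<lambda>u. L (\<sigma> u)"
          "\<lambda>u. dist (L (\<sigma> u)) (R (\<tau> u))" a b c r])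
      show "c + 2 * r < dist a b" using c r0 unfolding r_def by auto
      fix u :: real assume u: "u \<in> {0..1}" "dist (L (\<sigma> u)) (R (\<tau> u)) \<le> c"
      then have "(\<sigma> u, \<tau> u) \<notin> S" using c1(2)[of "\<sigma> u" "\<tau> u"] c by auto
      moreover have "\<sigma> u \<in> {0..1}" "\<tau> u \<in> {0..1}" using sub u(1) by blast+
      ultimately show "dist (L (\<sigma> u)) a \<le> r \<or> dist (L (\<sigma> u)) b \<le> r"
        by (auto simp: S_def)
    qed (use contL\<sigma> contR\<tau> e01 ends c r0 in \<open>auto simp: a_def b_def intro!: continuous_intros\<close>)
    define X where "X w = (R (\<tau> w) - L (\<sigma> w)) $ 1" for w
    \<comment> \<open>A chord without horizontal component is exactly as long as its height error.\<close>
    have X0: "X w \<noteq> 0" if w: "w \<in> {u..v}" for w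
    proof
      assume "X w = 0"
      then have "norm (R (\<tau> w) - L (\<sigma> w)) = \<bar>tilt k (R (\<tau> w) - L (\<sigma> w))\<bar>"
        using norm_vertical unfolding X_def tilt_def by simp
      also have "\<dots> < c" using close[of w] w uv by (auto simp: tilt_diff)
      finally show False using uv(6)[OF w] by (simp add: dist_norm norm_minus_commute)
    qed
    have sub': "{u..v} \<subseteq> {0..1}" using uv by auto
    have contX: "continuous_on {u..v} X"
      unfolding X_def
      by (intro continuous_intros continuous_on_subset[OF contL\<sigma> sub'] continuous_on_subset[OF contR\<tau> sub'])
    have "0 \<le> X u * X v"
    proof (rule ccontr)
      assume "\<not> 0 \<le> X u * X v"
      then have "X u \<le> 0 \<and> 0 \<le> X v \<or> X v \<le> 0 \<and> 0 \<le> X u"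
        by (auto simp: not_le mult_less_0_iff)
      then obtain w where "w \<in> {u..v}" "X w = 0"
        using connected_real_zero[OF connected_Icc contX, of u v]
          connected_real_zero[OF connected_Icc contX, of v u] uv by auto
      then show False using X0 by auto
    qed
    moreover have "\<sigma> u \<in> {0..1}" "\<tau> u \<in> {0..1}" "\<sigma> v \<in> {0..1}" "\<tau> v \<in> {0..1}"
    proof -
      have "u \<in> {0..1}" "v \<in> {0..1}" using uv(1-3) by auto
      then show "\<sigma> u \<in> {0..1}" "\<tau> u \<in> {0..1}" "\<sigma> v \<in> {0..1}" "\<tau> v \<in> {0..1}"
        using sub by blast+
    qed
    moreover have "\<bar>tilt k (R (\<tau> w) - L (\<sigma> w))\<bar> < \<epsilon>" if "w \<in> {u..v}" for w
      using close[of w] that uv(1-3) by (simp add: tilt_diff)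
    ultimately show "\<exists>s\<in>{0..1}. \<exists>t\<in>{0..1}. \<exists>s'\<in>{0..1}. \<exists>t'\<in>{0..1}.
       \<bar>tilt k (R t - L s)\<bar> < \<epsilon> \<and> \<bar>tilt k (R t' - L s')\<bar> < \<epsilon> \<and>
       c \<le> dist (L s) (R t) \<and> dist (L s') (R t') = dist (L s) (R t) \<and>
       dist (L s) (L s') = dist (L s) (R t) \<and> 0 \<le> (R t - L s) $ 1 * (R t' - L s') $ 1"
      using uv(2,4,5) uv(6)[of u]
      by (intro bexI[of _ "\<sigma> u"] bexI[of _ "\<tau> u"] bexI[of _ "\<sigma> v"] bexI[of _ "\<tau> v"])
        (simp_all add: X_def)
  qed
qed

lemma equal_vectors_of_slope:
  fixes V W :: "real^2"
  assumes "tilt k V = 0" "tilt k W = 0" "norm V = norm W" "0 \<le> V $ 1 * W $ 1"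
  shows "V = W"
proof -
  have eq: "V $ 2 = k * V $ 1" "W $ 2 = k * W $ 1"
    using assms(1,2) by (auto simp: tilt_def)
  have "(norm X)\<^sup>2 = (1 + k\<^sup>2) * (X $ 1)\<^sup>2" if "X $ 2 = k * X $ 1" for X :: "real^2"
    unfolding power2_norm_eq_inner inner_vec_def sum_2 that
    by (simp add: algebra_simps power2_eq_square)
  then have "(1 + k\<^sup>2) * (V $ 1)\<^sup>2 = (1 + k\<^sup>2) * (W $ 1)\<^sup>2"
    using eq assms(3) by metis
  moreover have "1 + k\<^sup>2 \<noteq> 0" using zero_le_power2[of k] by linarith
  ultimately have "V $ 1 = W $ 1 \<or> V $ 1 = - W $ 1" by (simp add: power2_eq_iff)
  then have "V $ 1 = W $ 1" using assms(4)
    by (auto simp: mult_le_0_iff zero_le_mult_iff)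
  then show ?thesis by (simp add: vec_eq_iff forall_2 eq)
qed

text \<open>
  All conditions on the four parameters are collected in one continuous nonnegative \<open>defect\<close> on a
  compact cube. Its infimum is \<open>0\<close> by the approximate version and is attained.
\<close>
lemma parallel_chords:
  fixes L R :: "real \<Rightarrow> real^2"
  assumes contL: "continuous_on {0..1} L" and contR: "continuous_on {0..1} R"
    and ends: "L 0 = R 0" "L 1 = R 1"
    and meet: "\<And>s t. s \<in> {0..1} \<Longrightarrow> t \<in> {0..1} \<Longrightarrow> L s = R t \<Longrightarrow> s = 0 \<and> t = 0 \<or> s = 1 \<and> t = 1"
    and rL: "\<And>s. s \<in> {0..1} \<Longrightarrow> tilt k (L s) \<in> {tilt k (L 1)..tilt k (L 0)}"
    and rR: "\<And>s. s \<in> {0..1} \<Longrightarrow> tilt k (R s) \<in> {tilt k (L 1)..tilt k (L 0)}"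
  obtains s t s' t' W where "s \<in> {0..1}" "t \<in> {0..1}" "s' \<in> {0..1}" "t' \<in> {0..1}"
    "R t = L s + W" "R t' = L s' + W" "W \<noteq> 0" "tilt k W = 0" "dist (L s) (L s') = norm W"
proof -
  obtain c where c: "c > 0"
    "\<And>\<epsilon>. \<epsilon> > 0 \<Longrightarrow> \<exists>s\<in>{0..1}. \<exists>t\<in>{0..1}. \<exists>s'\<in>{0..1}. \<exists>t'\<in>{0..1}.
       \<bar>tilt k (R t - L s)\<bar> < \<epsilon> \<and> \<bar>tilt k (R t' - L s')\<bar> < \<epsilon> \<and>
       c \<le> dist (L s) (R t) \<and> dist (L s') (R t') = dist (L s) (R t) \<and>
       dist (L s) (L s') = dist (L s) (R t) \<and> 0 \<le> (R t - L s) $ 1 * (R t' - L s') $ 1"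
    using approximate_parallel_chords[OF assms] by blast
  define I where "I = {0..1::real}"
  define defect where "defect = (\<lambda>(s,t,s',t').
      \<bar>tilt k (R t - L s)\<bar> + \<bar>tilt k (R t' - L s')\<bar> + max 0 (c - dist (L s) (R t))
      + \<bar>dist (L s') (R t') - dist (L s) (R t)\<bar> + \<bar>dist (L s) (L s') - dist (L s) (R t)\<bar>
      + max 0 (- ((R t - L s) $ 1 * (R t' - L s') $ 1)))"
  have comp: "compact (I \<times> I \<times> I \<times> I)" and ne: "I \<times> I \<times> I \<times> I \<noteq> {}"
    unfolding I_def by (auto intro!: compact_Times)
  have contI: "continuous_on (I \<times> I \<times> I \<times> I) (\<lambda>z. L (fst z))"
    "continuous_on (I \<times> I \<times> I \<times> I) (\<lambda>z. R (fst (snd z)))"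
    "continuous_on (I \<times> I \<times> I \<times> I) (\<lambda>z. L (fst (snd (snd z))))"
    "continuous_on (I \<times> I \<times> I \<times> I) (\<lambda>z. R (snd (snd (snd z))))"
    by (auto simp: I_def intro!: continuous_intros continuous_on_compose2[OF contL] continuous_on_compose2[OF contR])
  have "continuous_on (I \<times> I \<times> I \<times> I) defect"
    unfolding defect_def case_prod_unfold by (intro continuous_intros contI)
  from continuous_attains_inf[OF comp ne this] obtain s t s' t' where
    mem: "s \<in> I" "t \<in> I" "s' \<in> I" "t' \<in> I"
    and least: "\<And>z. z \<in> I \<times> I \<times> I \<times> I \<Longrightarrow> defect (s,t,s',t') \<le> defect z"
    by fastforce
  have "defect (s,t,s',t') \<le> \<epsilon>" if "\<epsilon> > 0" for \<epsilon>
  proof -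
    obtain u v u' v' where uv: "u \<in> I" "v \<in> I" "u' \<in> I" "v' \<in> I"
      "\<bar>tilt k (R v - L u)\<bar> < \<epsilon> / 2 \<and> \<bar>tilt k (R v' - L u')\<bar> < \<epsilon> / 2 \<and>
       c \<le> dist (L u) (R v) \<and> dist (L u') (R v') = dist (L u) (R v) \<and>
       dist (L u) (L u') = dist (L u) (R v) \<and> 0 \<le> (R v - L u) $ 1 * (R v' - L u') $ 1"
      using c(2)[of "\<epsilon> / 2"] \<open>\<epsilon> > 0\<close> unfolding I_def by auto
    have "defect (u,v,u',v') \<le> \<epsilon>" using uv(5) by (simp add: defect_def)
    then show ?thesis using least[of "(u,v,u',v')"] uv by auto
  qed
  then have "defect (s,t,s',t') \<le> 0" using field_le_epsilon[of _ 0] by auto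
  then have z: "tilt k (R t - L s) = 0" "tilt k (R t' - L s') = 0" "c \<le> dist (L s) (R t)"
    "dist (L s') (R t') = dist (L s) (R t)" "dist (L s) (L s') = dist (L s) (R t)"
    "0 \<le> (R t - L s) $ 1 * (R t' - L s') $ 1"
    unfolding defect_def case_prod_conv by linarith+
  have same: "R t - L s = R t' - L s'"
    by (rule equal_vectors_of_slope[of k]) (use z in \<open>auto simp: dist_norm norm_minus_commute\<close>)
  have "R t = L s + (R t - L s)" by simp
  moreover have "R t' = L s' + (R t - L s)" unfolding same by simp
  moreover have "R t - L s \<noteq> 0" "dist (L s) (L s') = norm (R t - L s)"
    using z(3,5) c(1) by (auto simp: dist_norm norm_minus_commute)
  ultimately show thesis
    using that[of s t s' t' "R t - L s"] mem z(1) by (auto simp: I_def)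
qed

section \<open>The rhombus\<close>

text \<open>
  This rules out a flat rhombus, whose two sides of slope \<open>k\<close> lie on one line and have an endpoint \<open>E\<close>
  in common.
\<close>
lemma lex_extreme_not_midpoint:
  fixes E W :: "real^2"
  assumes "E + W \<in> S" "E - W \<in> S" "tilt k W = 0"
    and extreme: "(\<forall>z\<in>S. tilt k z = tilt k E \<longrightarrow> E $ 1 \<le> z $ 1) \<or>
      (\<forall>z\<in>S. tilt k z = tilt k E \<longrightarrow> z $ 1 \<le> E $ 1)"
  shows "W = 0"
proof -
  have "tilt k (E + W) = tilt k E" "tilt k (E - W) = tilt k E"
    using assms(3) by (auto simp: tilt_add tilt_diff)
  then have "E $ 1 \<le> (E + W) $ 1 \<and> E $ 1 \<le> (E - W) $ 1
      \<or> (E + W) $ 1 \<le> E $ 1 \<and> (E - W) $ 1 \<le> E $ 1"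
    using extreme assms(1,2) by blast
  then have "W $ 1 = 0" by auto
  then show ?thesis using assms(3) by (auto simp: tilt_def vec_eq_iff forall_2)
qed

text \<open>
  The arcs turn through the angles \<open>\<delta>\<close> and \<open>2 * pi - \<delta>\<close> in opposite directions. They meet at \<open>l s = r t\<close>
  only if the sum of the two angles travelled is \<open>0\<close> or \<open>2 * pi\<close>, that is at the two ends.
\<close>
lemma circle_two_arcs:
  assumes "z1 \<in> sphere 0 1" "z2 \<in> sphere (0::complex) 1" "z1 \<noteq> z2"
  obtains l r :: "real \<Rightarrow> complex" where "continuous_on UNIV l" "continuous_on UNIV r"
    "range l \<subseteq> sphere 0 1" "range r \<subseteq> sphere 0 1" "l 0 = z1" "r 0 = z1" "l 1 = z2" "r 1 = z2"
    "\<And>s t. s \<in> {0..1} \<Longrightarrow> t \<in> {0..1} \<Longrightarrow> l s = r t \<Longrightarrow> s = 0 \<and> t = 0 \<or> s = 1 \<and> t = 1"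
proof -
  have n: "norm z1 = 1" "norm z2 = 1" "z1 \<noteq> 0" using assms by auto
  define \<delta> where "\<delta> = Arg2pi (z2 / z1)"
  have z2: "z2 = z1 * cis \<delta>"
    using Arg2pi_eq[of "z2 / z1"] n by (simp add: \<delta>_def cis_conv_exp norm_divide field_simps)
  have "\<delta> \<noteq> 0" using z2 assms(3) by auto
  then have \<delta>: "0 < \<delta>" "\<delta> < 2 * pi"
    using Arg2pi_ge_0[of "z2 / z1"] Arg2pi_lt_2pi[of "z2 / z1"] by (auto simp: \<delta>_def)
  define l r where "l s = z1 * cis (s * \<delta>)" and "r t = z1 * cis (- (t * (2 * pi - \<delta>)))" for s t
  show thesis
  proof (rule that[of l r])
    show "continuous_on UNIV l" "continuous_on UNIV r"
      unfolding l_def r_def cis_conv_exp by (intro continuous_intros)+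
    show "range l \<subseteq> sphere 0 1" "range r \<subseteq> sphere 0 1"
      using n by (auto simp: l_def r_def norm_mult)
    show "l 0 = z1" "r 0 = z1" "l 1 = z2" by (auto simp: l_def r_def z2)
    show "r 1 = z2" by (simp add: r_def z2 complex_eq_iff cos_diff sin_diff)
    fix s t :: real
    assume s: "s \<in> {0..1}" and t: "t \<in> {0..1}" and eq: "l s = r t"
    define \<phi> where "\<phi> = s * \<delta> + t * (2 * pi - \<delta>)"
    have "cis \<phi> = cis (s * \<delta>) / cis (- (t * (2 * pi - \<delta>)))"
      by (simp add: cis_divide \<phi>_def)
    also have "\<dots> = 1" using eq n by (simp add: l_def r_def)
    finally have "cos \<phi> = 1" by (metis cis.sel(1) one_complex.sel(1))
    then obtain n :: int where n: "\<phi> = n * 2 * pi" by (auto simp: cos_one_2pi_int)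
    have b: "0 \<le> s * \<delta>" "s * \<delta> \<le> \<delta>" "0 \<le> t * (2 * pi - \<delta>)" "t * (2 * pi - \<delta>) \<le> 2 * pi - \<delta>"
      using s t \<delta> mult_left_le_one_le[of \<delta> s] mult_left_le_one_le[of "2 * pi - \<delta>" t] by auto
    then have "0 \<le> n * (2 * pi)" "n * (2 * pi) \<le> 1 * (2 * pi)" using n unfolding \<phi>_def by linarith+
    then have "0 \<le> n" "n \<le> 1"
      using pi_gt_zero by (auto simp: zero_le_mult_iff mult_le_cancel_right simp del: mult_1)
    then consider "n = 0" | "n = 1" by linarith
    then show "s = 0 \<and> t = 0 \<or> s = 1 \<and> t = 1"
    proof cases
      case 1
      then have "s * \<delta> + t * (2 * pi - \<delta>) = 0" using n unfolding \<phi>_def by simp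
      then have "s * \<delta> = 0" "t * (2 * pi - \<delta>) = 0" using b by linarith+
      then show ?thesis using \<delta> by auto
    next
      case 2
      then have "s * \<delta> + t * (2 * pi - \<delta>) = 2 * pi" using n unfolding \<phi>_def by simp
      then have "s * \<delta> = \<delta>" "t * (2 * pi - \<delta>) = 2 * pi - \<delta>" using b by linarith+
      then show ?thesis using \<delta> by auto
    qed
  qed
qed

lemma compact_attains_lex_sup:
  fixes f g :: "'a::t2_space \<Rightarrow> real"
  assumes "compact S" "S \<noteq> {}" and contf: "continuous_on S f" and contg: "continuous_on S g"
  obtains x where "x \<in> S" "\<And>z. z \<in> S \<Longrightarrow> f z \<le> f x"
    "\<And>z. z \<in> S \<Longrightarrow> f z = f x \<Longrightarrow> g z \<le> g x"
proof -
  obtain x0 where x0: "x0 \<in> S" "\<And>z. z \<in> S \<Longrightarrow> f z \<le> f x0"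
    using continuous_attains_sup[OF assms(1-3)] by blast
  define M where "M = {z \<in> S. f z = f x0}"
  have "M = S \<inter> f -` {f x0}" by (auto simp: M_def)
  moreover have "closedin (top_of_set S) (S \<inter> f -` {f x0})"
    by (rule continuous_closedin_preimage[OF contf]) simp
  ultimately have "compact M" using closedin_compact[OF assms(1)] by simp
  moreover have "M \<noteq> {}" "M \<subseteq> S" using x0 by (auto simp: M_def)
  ultimately obtain x where x: "x \<in> M" "\<And>z. z \<in> M \<Longrightarrow> g z \<le> g x"
    using continuous_attains_sup[of M g] continuous_on_subset[OF contg] by blast
  show thesis using that[of x] x x0 by (auto simp: M_def)
qed

lemma inscribed_rhombus_with_side_of_slope:
  assumes "jordan_curve \<gamma>"
  obtains R p q where "inscribed_rhombus \<gamma> R" "p \<in> R" "q \<in> R" "p \<noteq> q" "tilt k (q - p) = 0"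
proof -
  define S where "S = \<gamma> ` sphere 0 1"
  have cont: "continuous_on (sphere 0 1) \<gamma>" and inj: "inj_on \<gamma> (sphere 0 1)"
    using assms by (auto simp: jordan_curve_def)
  have compS: "compact S" unfolding S_def by (intro compact_continuous_image cont) auto
  have neS: "S \<noteq> {}" by (auto simp: S_def)
  obtain T where T: "T \<in> S" "\<And>z. z \<in> S \<Longrightarrow> tilt k z \<le> tilt k T"
    "\<And>z. z \<in> S \<Longrightarrow> tilt k z = tilt k T \<Longrightarrow> - z $ 1 \<le> - T $ 1"
    by (rule compact_attains_lex_sup[OF compS neS, of "tilt k" "\<lambda>z. - z $ 1"])
      (auto intro!: continuous_intros)
  \<comment> \<open>Opposite tie-breaking at the bottom forces \<open>T \<noteq> B\<close> even if the whole curve had constant tilt.\<close>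
  obtain B where B: "B \<in> S" "\<And>z. z \<in> S \<Longrightarrow> - tilt k z \<le> - tilt k B"
    "\<And>z. z \<in> S \<Longrightarrow> - tilt k z = - tilt k B \<Longrightarrow> z $ 1 \<le> B $ 1"
    by (rule compact_attains_lex_sup[OF compS neS, of "\<lambda>z. - tilt k z" "\<lambda>z. z $ 1"])
      (auto intro!: continuous_intros)
  have "T \<noteq> B"
  proof
    assume "T = B"
    have "z = T" if "z \<in> S" for z
    proof -
      have "tilt k z = tilt k T" using T(2) B(2) that \<open>T = B\<close> by force
      moreover have "z $ 1 = T $ 1"
        using T(3)[OF that] B(3)[OF that] \<open>T = B\<close> calculation by simp
      ultimately show ?thesis by (simp add: tilt_def vec_eq_iff forall_2)
    qed
    then have "\<gamma> 1 = T" "\<gamma> (-1) = T" by (auto simp: S_def)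
    then show False using inj_onD[OF inj, of 1 "-1"] by simp
  qed
  obtain zT zB where z: "zT \<in> sphere 0 1" "\<gamma> zT = T" "zB \<in> sphere 0 1" "\<gamma> zB = B"
    using T(1) B(1) by (auto simp: S_def)
  with \<open>T \<noteq> B\<close> have "zT \<noteq> zB" by auto
  obtain l r where lr: "continuous_on UNIV l" "continuous_on UNIV r"
    "range l \<subseteq> sphere 0 1" "range r \<subseteq> sphere 0 1" "l 0 = zT" "r 0 = zT" "l 1 = zB" "r 1 = zB"
    "\<And>s t. s \<in> {0..1::real} \<Longrightarrow> t \<in> {0..1::real} \<Longrightarrow> l s = r t \<Longrightarrow> s = 0 \<and> t = 0 \<or> s = 1 \<and> t = 1"
    using circle_two_arcs[OF z(1,3) \<open>zT \<noteq> zB\<close>] by metis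
  define L R where "L s = \<gamma> (l s)" and "R t = \<gamma> (r t)" for s t
  have ends: "L 0 = T" "R 0 = T" "L 1 = B" "R 1 = B" using lr z by (auto simp: L_def R_def)
  have inS: "L s \<in> S" "R s \<in> S" for s
    using lr(3,4) unfolding L_def R_def S_def by blast+
  have meet: "s = 0 \<and> t = 0 \<or> s = 1 \<and> t = 1"
    if "s \<in> {0..1}" "t \<in> {0..1}" "L s = R t" for s t
  proof (rule lr(9)[OF that(1,2)])
    have "l s \<in> sphere 0 1" "r t \<in> sphere 0 1" using lr(3,4) by blast+
    then show "l s = r t" using inj_onD[OF inj] that(3) unfolding L_def R_def by blast
  qed
  have contLR: "continuous_on {0..1} L" "continuous_on {0..1} R"
    unfolding L_def R_def
    by (rule continuous_on_compose2[OF cont]; use lr in \<open>auto intro: continuous_on_subset\<close>)+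
  have range: "tilt k x \<in> {tilt k (L 1)..tilt k (L 0)}" if "x \<in> S" for x
    using T(2)[OF that] B(2)[OF that] by (simp add: ends)
  obtain s t s' t' W where
    mem: "s \<in> {0..1}" "t \<in> {0..1}" "s' \<in> {0..1}" "t' \<in> {0..1}"
    and W: "R t = L s + W" "R t' = L s' + W" "W \<noteq> 0" "tilt k W = 0" "dist (L s) (L s') = norm W"
    by (rule parallel_chords[OF contLR _ _ meet range range]) (use ends inS in auto)
  define p p' where "p = L s" and "p' = L s'"
  have pS: "p \<in> S" "p + W \<in> S" "p' \<in> S" "p' + W \<in> S"
    using inS[of s] inS[of s'] inS(2)[of t] inS(2)[of t'] W(1,2) by (auto simp: p_def p'_def)
  have no_touch: "x \<noteq> y + W" if xy: "x = p \<and> y = p' \<or> x = p' \<and> y = p" for x y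
  proof
    assume "x = y + W"
    then have "x = T \<or> x = B"
      using xy meet[of s t'] meet[of s' t] mem W(1,2) ends by (auto simp: p_def p'_def)
    moreover have "x + W \<in> S" "x - W \<in> S" using xy pS \<open>x = y + W\<close> by auto
    ultimately have "W = 0"
      using lex_extreme_not_midpoint[of x W S k] W(4) T(3) B(3) by auto
    then show False using W(3) by simp
  qed
  have "p \<noteq> p' + W" "p' \<noteq> p + W" using no_touch by blast+
  moreover have "p \<noteq> p'" using W(3,5) by (auto simp: p_def p'_def)
  ultimately have "rhombus p (p + W) (p' + W) p'"
    using W(3,5) by (auto simp: rhombus_def p_def p'_def dist_norm norm_minus_commute)
  then have "inscribed_rhombus \<gamma> {p, p + W, p' + W, p'}"
    unfolding inscribed_rhombus_def using pS S_def by blast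
  then show thesis using that[of _ p "p + W"] W(3,4) by auto
qed

theorem mainTheorem2:
  fixes \<gamma> :: "complex \<Rightarrow> real^2"
  assumes "jordan_curve \<gamma>"
  shows "uncountable {R. inscribed_rhombus \<gamma> R}"
proof
  assume count: "countable {R. inscribed_rhombus \<gamma> R}"
  have "countable (\<Union>R\<in>{R. inscribed_rhombus \<gamma> R}. R \<times> R)"
  proof (rule countable_UN[OF count])
    fix R assume "R \<in> {R. inscribed_rhombus \<gamma> R}"
    then have "finite R" unfolding inscribed_rhombus_def by blast
    then show "countable (R \<times> R)" by (simp add: countable_finite)
  qed
  then have "countable ((\<lambda>(p, q). (q - p) $ 2 / (q - p) $ 1) ` (\<Union>R\<in>{R. inscribed_rhombus \<gamma> R}. R \<times> R))"
    (is "countable ?slopes") by (rule countable_image)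
  moreover have "k \<in> ?slopes" for k
  proof -
    obtain R p q where R: "inscribed_rhombus \<gamma> R" "p \<in> R" "q \<in> R" "p \<noteq> q" "tilt k (q - p) = 0"
      using inscribed_rhombus_with_side_of_slope[OF assms, of k] by blast
    have "(q - p) $ 1 \<noteq> 0"
      using R(4,5) by (auto simp: tilt_def vec_eq_iff forall_2)
    then have "k = (q - p) $ 2 / (q - p) $ 1"
      using R(5) by (simp add: tilt_def field_simps)
    then show ?thesis using R by (intro image_eqI[of _ _ "(p, q)"]) auto
  qed
  then have "UNIV \<subseteq> ?slopes" by blast
  ultimately have "countable (UNIV :: real set)"
    by (rule countable_subset[rotated])
  then show False using uncountable_UNIV_real by simp
qed

end
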